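(* Let $I\subset\mathbb{R}$ be an interval with interior $I^{o}$, let $f:I^{o}\to\mathbb{R}$ be differentiable on $I^{o}$, and let $a,b\in I^{o}$ with $a<b$. If $|f'|$ is quasi-convex on $[a,b]$, then for every $x\in[a,b]$ the following inequality holds: $$\left|\frac{(b-x)f(b)+(x-a)f(a)}{b-a}-\frac{1}{b-a}\int_{a}^{b}f(u)\,du\right|\le \frac{(x-a)^{2}}{2(b-a)}\max\{|f'(x)|,|f'(a)|\}+\frac{(b-x)^{2}}{2(b-a)}\max\{|f'(x)|,|f'(b)|\}.$$
   Context: A function $g:[a,b]\to\mathbb{R}$ is called quasi-convex on $[a,b]$ if $g(\lambda u+(1-\lambda)v)\le\max\{g(u),g(v)\}$ for all $u,v\in[a,b]$ and all $\lambda\in[0,1]$. *)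

theory Defs
  imports "HOL-Analysis.Analysis"
begin

definition quasi_convex_on :: "real set \<Rightarrow> (real \<Rightarrow> real) \<Rightarrow> bool" where
  "quasi_convex_on S g \<longleftrightarrow>
    (\<forall>u\<in>S. \<forall>v\<in>S. \<forall>t\<in>{0..1}. g (t * u + (1 - t) * v) \<le> max (g u) (g v))"

end

theory Submission
  imports Defs
begin

text \<open>Splitting the integral at \<open>x\<close>, the quantity to be bounded is \<open>1 / (b - a)\<close> times the sum of
  the integrals of \<open>f a - f u\<close> over \<open>[a, x]\<close> and of \<open>f b - f u\<close> over \<open>[x, b]\<close>. The mean value theorem
  bounds the integrands by \<open>M * \<bar>u - a\<bar>\<close> and \<open>M' * \<bar>u - b\<bar>\<close>, where quasi-convexity allows
  \<open>M\<close> and \<open>M'\<close> to be the maxima of \<open>\<bar>f'\<bar>\<close> over the endpoints of the two pieces. Unlike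
  integration by parts, this needs no integrability of \<open>f'\<close>.\<close>

text \<open>Every point of \<open>{p..q}\<close> is a convex combination of \<open>p\<close> and
  \<open>q\<close>. This yields a single constant bounding the derivative on a whole piece.\<close>

lemma quasi_convex_on_le_max:
  assumes "quasi_convex_on S g" "p \<in> S" "q \<in> S" "u \<in> {p..q}"
  shows "g u \<le> max (g p) (g q)"
proof -
  have "u \<in> closed_segment p q"
    using assms(4) by (auto simp: closed_segment_eq_real_ivl)
  then obtain t where t: "0 \<le> t" "t \<le> 1" "u = (1 - t) * p + t * q"
    by (auto simp: in_segment)
  with assms(1-3) have "g (t * q + (1 - t) * p) \<le> max (g q) (g p)"
    unfolding quasi_convex_on_def by auto
  then show ?thesis
    by (simp add: t(3) add.commute max.commute)
qed

lemma has_integral_abs_diff_endpoint: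
  fixes p q c :: real
  assumes "p \<le> q" "c \<in> {p, q}"
  shows "((\<lambda>u. \<bar>u - c\<bar>) has_integral (q - p)\<^sup>2 / 2) {p..q}"
proof -
  \<comment> \<open>\<open>s\<close> is the sign of \<open>u - c\<close> on \<open>{p..q}\<close>,
    constant because \<open>c\<close> is an endpoint; so \<open>s * (u - c)\<^sup>2 / 2\<close> is
    an antiderivative in both cases.\<close>
  define s :: real where "s = (if c = p then 1 else -1)"
  have "((\<lambda>u. s * (u - c)) has_integral s * (q - c)\<^sup>2 / 2 - s * (p - c)\<^sup>2 / 2) {p..q}"
    using assms(1)
    by (intro fundamental_theorem_of_calculus)
       (auto intro!: derivative_eq_intros
             simp: has_real_derivative_iff_has_vector_derivative [symmetric])
  also have "s * (q - c)\<^sup>2 / 2 - s * (p - c)\<^sup>2 / 2 = (q - p)\<^sup>2 / 2"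
    using assms(2) by (auto simp: s_def power2_commute)
  finally show ?thesis
    by (rule has_integral_eq [rotated]) (use assms in \<open>auto simp: s_def\<close>)
qed

text \<open>Integrating the pointwise bound
  \<open>\<bar>f c - f u\<bar> \<le> M * \<bar>u - c\<bar>\<close> gives the estimate. Allowing
  either endpoint as \<open>c\<close> lets one lemma serve both pieces.\<close>

lemma endpoint_rectangle_rule_error:
  fixes f :: "real \<Rightarrow> real"
  assumes "p \<le> q" "c \<in> {p, q}"
    and diff: "\<And>u. u \<in> {p..q} \<Longrightarrow> f differentiable (at u)"
    and bound: "\<And>u. u \<in> {p..q} \<Longrightarrow> \<bar>deriv f u\<bar> \<le> M"
  shows "\<bar>(q - p) * f c - integral {p..q} f\<bar> \<le> (q - p)\<^sup>2 / 2 * M"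
proof -
  have "continuous_on {p..q} f"
    using diff
    by (meson continuous_at_imp_continuous_on differentiable_imp_continuous_within)
  then have "(f has_integral integral {p..q} f) {p..q}"
    by (intro integrable_integral integrable_continuous_real)
  moreover have "((\<lambda>u. f c) has_integral (q - p) * f c) {p..q}"
    using has_integral_const_real [of "f c" p q] assms(1) by simp
  ultimately have I: "((\<lambda>u. f c - f u) has_integral (q - p) * f c - integral {p..q} f) {p..q}"
    by (rule has_integral_diff [rotated])
  have J: "((\<lambda>u. \<bar>u - c\<bar> * M) has_integral (q - p)\<^sup>2 / 2 * M) {p..q}"
    using assms(1,2) by (intro has_integral_mult_left has_integral_abs_diff_endpoint)
  have deriv: "(f has_field_derivative deriv f u) (at u within {p..q})" if "u \<in> {p..q}" for u
    using diff [OF that] by (simp add: DERIV_deriv_iff_real_differentiable has_field_derivative_at_within)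
  have le: "norm (f c - f u) \<le> \<bar>u - c\<bar> * M" if "u \<in> {p..q}" for u
    \<comment> \<open>This is the mean value inequality on the convex set \<open>{p..q}\<close>,
      between \<open>u\<close> and \<open>c\<close>.\<close>
    using field_differentiable_bound [of "{p..q}" f "deriv f" M u c] deriv bound that assms(1,2)
    by (auto simp: abs_minus_commute mult.commute)
  have "norm (integral {p..q} (\<lambda>u. f c - f u)) \<le> integral {p..q} (\<lambda>u. \<bar>u - c\<bar> * M)"
    using I J le by (intro integral_norm_bound_integral) (auto simp: has_integral_integrable)
  then show ?thesis
    unfolding integral_unique [OF I] integral_unique [OF J] by simp
qed

theorem theorem6:
  fixes I :: "real set" and f :: "real \<Rightarrow> real" and a b :: real
  assumes "is_interval I"
    and "\<forall>x\<in>interior I. f differentiable (at x)"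
    and "a \<in> interior I" and "b \<in> interior I" and "a < b"
    and "quasi_convex_on {a..b} (\<lambda>x. \<bar>deriv f x\<bar>)"
  shows "\<forall>x\<in>{a..b}.
    \<bar>((b - x) * f b + (x - a) * f a) / (b - a) - 1 / (b - a) * integral {a..b} f\<bar>
      \<le> (x - a)\<^sup>2 / (2 * (b - a)) * max \<bar>deriv f x\<bar> \<bar>deriv f a\<bar>
        + (b - x)\<^sup>2 / (2 * (b - a)) * max \<bar>deriv f x\<bar> \<bar>deriv f b\<bar>"
proof
  fix x assume x: "x \<in> {a..b}"
  have "is_interval (interior I)"
    \<comment> \<open>The interior of a convex set is convex, so \<open>{a..b}\<close> lies inside
      \<open>interior I\<close> and \<open>f\<close> is differentiable even at \<open>a\<close> and
      \<open>b\<close> in the two-sided sense.\<close>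
    using assms(1) by (simp add: is_interval_convex_1 convex_interior)
  then have diff: "f differentiable (at u)" if "u \<in> {a..b}" for u
    using assms(2-4) that by (meson atLeastAtMost_iff mem_is_interval_1_I)
  then have "continuous_on {a..b} f"
    by (meson continuous_at_imp_continuous_on differentiable_imp_continuous_within)
  then have split: "integral {a..b} f = integral {a..x} f + integral {x..b} f"
    using x by (simp add: Henstock_Kurzweil_Integration.integral_combine integrable_continuous_real)
  let ?A = "(x - a) * f a - integral {a..x} f" and ?B = "(b - x) * f b - integral {x..b} f"
  let ?M = "max \<bar>deriv f x\<bar> \<bar>deriv f a\<bar>" and ?N = "max \<bar>deriv f x\<bar> \<bar>deriv f b\<bar>"
  \<comment> \<open>Here \<open>c\<close> is the left endpoint \<open>a\<close> of
    \<open>{a..x}\<close>; for \<open>?B\<close> it is the right endpoint \<open>b\<close> of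
    \<open>{x..b}\<close>. Either piece may be a single point.\<close>
  have A: "\<bar>?A\<bar> \<le> (x - a)\<^sup>2 / 2 * ?M"
    using x quasi_convex_on_le_max [OF assms(6), of a x]
    by (intro endpoint_rectangle_rule_error diff) (auto simp: max.commute)
  have B: "\<bar>?B\<bar> \<le> (b - x)\<^sup>2 / 2 * ?N"
    using x quasi_convex_on_le_max [OF assms(6), of x b]
    by (intro endpoint_rectangle_rule_error diff) auto
  have "((b - x) * f b + (x - a) * f a) / (b - a) - 1 / (b - a) * integral {a..b} f
      = (?A + ?B) / (b - a)"
    by (simp add: split add_divide_distrib diff_divide_distrib)
  then have "\<bar>((b - x) * f b + (x - a) * f a) / (b - a) - 1 / (b - a) * integral {a..b} f\<bar>
      = \<bar>?A + ?B\<bar> / (b - a)"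
    using assms(5) by simp
  also have "\<dots> \<le> ((x - a)\<^sup>2 / 2 * ?M + (b - x)\<^sup>2 / 2 * ?N) / (b - a)"
    using A B assms(5) by (intro divide_right_mono) linarith+
  also have "\<dots> = (x - a)\<^sup>2 / (2 * (b - a)) * ?M + (b - x)\<^sup>2 / (2 * (b - a)) * ?N"
    by (simp add: add_divide_distrib)
  finally show "\<bar>((b - x) * f b + (x - a) * f a) / (b - a) - 1 / (b - a) * integral {a..b} f\<bar>
      \<le> (x - a)\<^sup>2 / (2 * (b - a)) * ?M + (b - x)\<^sup>2 / (2 * (b - a)) * ?N" .
qed

end
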